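(* Let $E$ be a finite-dimensional real vector space with a norm $\|\cdot\|$, $Q\subset E$ nonempty, convex and compact, and $h:Q\to\mathbb{R}$ a function (not assumed to be smooth or concave) admitting a $(\delta_k,L_k)$-oracle for each $k\ge1$, where $\delta_k,L_k\ge0$. Let $\{\lambda_k\}_{k\ge1}$, $\{\tilde\lambda_k\}_{k\ge1}$ and $\{B_k\}_{k\ge0}$ be the iterates and upper bounds on $h^*=\sup_{\lambda\in Q}h(\lambda)$ generated by the Frank-Wolfe method with the $(\delta,L)$-oracle, with an arbitrary step-size sequence $\{\bar\alpha_k\}_{k\ge1}\subset[0,1)$, and let $\{\alpha_k\},\{\beta_k\}$ be the associated dual averages sequences. Then for every $k\ge0$: $$B_k-h(\lambda_{k+1})\le\frac{B_k-h(\lambda_1)}{\beta_{k+1}}+\frac{\frac12\mathrm{Diam}_Q^2\sum_{i=1}^kL_i\frac{\alpha_i^2}{\beta_{i+1}}}{\beta_{k+1}}+\frac{\sum_{i=1}^k\beta_{i+1}\delta_i}{\beta_{k+1}}.$$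
   Context: Notation: $E^*$ is the dual space of $E$ and $s^T\lambda$ is the evaluation of $s\in E^*$ at $\lambda\in E$. $\mathrm{Diam}_Q:=\max_{\lambda,\bar\lambda\in Q}\|\lambda-\bar\lambda\|$. $(\delta,L)$-oracle: for $\delta,L\ge0$, a $(\delta,L)$-oracle for $h$ is a (possibly non-unique) mapping $Q\to\mathbb{R}\times E^*$, $\bar\lambda\mapsto(h_{(\delta,L)}(\bar\lambda),g_{(\delta,L)}(\bar\lambda))$, such that for all $\lambda,\bar\lambda\in Q$: $$h(\lambda)\le h_{(\delta,L)}(\bar\lambda)+g_{(\delta,L)}(\bar\lambda)^T(\lambda-\bar\lambda),$$ $$h(\lambda)\ge h_{(\delta,L)}(\bar\lambda)+g_{(\delta,L)}(\bar\lambda)^T(\lambda-\bar\lambda)-\tfrac L2\|\lambda-\bar\lambda\|^2-\delta.$$ Frank-Wolfe method with the $(\delta,L)$-oracle: start at $\lambda_1\in Q$ with an upper bound $B_0\ge h^*$ ($B_0=+\infty$ allowed if no bound is available, inequalities being then read in the extended reals). At iteration $k\ge1$: compute $h_k=h_{(\delta_k,L_k)}(\lambda_k)$ and $g_k=g_{(\delta_k,L_k)}(\lambda_k)$; choose $\tilde\lambda_k\in\arg\max_{\lambda\in Q}\{h_k+g_k^T(\lambda-\lambda_k)\}$; set $B^w_k=h_k+g_k^T(\tilde\lambda_k-\lambda_k)$; set $B_k=\min\{B_{k-1},B^w_k,B^o_k\}$, where $B^o_k\ge h^*$ is any other (optional) upper bound on $h^*$ (omitted, or $+\infty$, if not computed);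 set $\lambda_{k+1}=\lambda_k+\bar\alpha_k(\tilde\lambda_k-\lambda_k)$ with $\bar\alpha_k\in[0,1)$. Dual averages sequences: $\beta_k=\frac{1}{\prod_{j=1}^{k-1}(1-\bar\alpha_j)}$ and $\alpha_k=\frac{\beta_k\bar\alpha_k}{1-\bar\alpha_k}$ for $k\ge1$. Empty products equal $1$, empty sums equal $0$. *)

theory Defs
  imports "HOL-Analysis.Analysis"
begin

text \<open>
  A function on \<open>Q\<close> is a function on the whole type of which only the values on \<open>Q\<close> matter.
  The dual space is the type of bounded linear functionals, which in finite dimension are all
  linear functionals.
\<close>

definition is_oracle ::
  "'e::real_normed_vector set \<Rightarrow> ('e \<Rightarrow> real) \<Rightarrow> real \<Rightarrow> real \<Rightarrow> ('e \<Rightarrow> real \<times> ('e \<Rightarrow>\<^sub>L real)) \<Rightarrow> bool"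
  where "is_oracle Q h \<delta> L orc \<longleftrightarrow>
    (\<forall>x\<in>Q. \<forall>y\<in>Q.
       h x \<le> fst (orc y) + blinfun_apply (snd (orc y)) (x - y) \<and>
       h x \<ge> fst (orc y) + blinfun_apply (snd (orc y)) (x - y) - L / 2 * (norm (x - y))\<^sup>2 - \<delta>)"

definition model ::
  "('e::real_normed_vector \<Rightarrow> real \<times> ('e \<Rightarrow>\<^sub>L real)) \<Rightarrow> 'e \<Rightarrow> 'e \<Rightarrow> real"
  where "model orc y x = fst (orc y) + blinfun_apply (snd (orc y)) (x - y)"

definition opt_value :: "'e set \<Rightarrow> ('e \<Rightarrow> real) \<Rightarrow> ereal"
  where "opt_value Q h = (SUP x\<in>Q. ereal (h x))"

text \<open>
  A run of the method: \<open>orc k\<close> is the oracle called at iteration \<open>k \<ge> 1\<close>, \<open>a k\<close> the step size,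
  \<open>lam k\<close> the iterate, \<open>lamt k\<close> the chosen maximiser of the linear model, \<open>B k\<close> the running upper
  bound. \<open>Bo k\<close> is the optional further upper bound; \<open>Bo k = \<infinity>\<close> means that none is computed.
  The entries at index 0 of all sequences other than \<open>B\<close> are irrelevant.
\<close>

definition frank_wolfe ::
  "'e::real_normed_vector set \<Rightarrow> ('e \<Rightarrow> real) \<Rightarrow> (nat \<Rightarrow> 'e \<Rightarrow> real \<times> ('e \<Rightarrow>\<^sub>L real)) \<Rightarrow>
   (nat \<Rightarrow> real) \<Rightarrow> (nat \<Rightarrow> ereal) \<Rightarrow> (nat \<Rightarrow> 'e) \<Rightarrow> (nat \<Rightarrow> 'e) \<Rightarrow> (nat \<Rightarrow> ereal) \<Rightarrow> bool"
  where "frank_wolfe Q h orc a Bo lam lamt B \<longleftrightarrow>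
    lam 1 \<in> Q \<and> B 0 \<ge> opt_value Q h \<and>
    (\<forall>k\<ge>1.
       is_arg_max (model (orc k) (lam k)) (\<lambda>x. x \<in> Q) (lamt k) \<and>
       Bo k \<ge> opt_value Q h \<and>
       B k = Min {B (k - 1), ereal (model (orc k) (lam k) (lamt k)), Bo k} \<and>
       0 \<le> a k \<and> a k < 1 \<and>
       lam (k + 1) = lam k + a k *\<^sub>R (lamt k - lam k))"

definition dual_beta :: "(nat \<Rightarrow> real) \<Rightarrow> nat \<Rightarrow> real"
  where "dual_beta a k = 1 / (\<Prod>j\<in>{1..<k}. 1 - a j)"

definition dual_alpha :: "(nat \<Rightarrow> real) \<Rightarrow> nat \<Rightarrow> real"
  where "dual_alpha a k = dual_beta a k * a k / (1 - a k)"

end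

theory Submission
  imports Defs
begin

text \<open>
  For every real \<open>b \<le> B k\<close> the scaled values satisfy
  \<open>\<beta>\<^sub>k\<^sub>+\<^sub>1 h(\<lambda>\<^sub>k\<^sub>+\<^sub>1) \<ge> h(\<lambda>\<^sub>1) + (\<beta>\<^sub>k\<^sub>+\<^sub>1 - 1) b - E\<^sub>k\<close>, where \<open>E\<^sub>k\<close> is the accumulated error. The induction
  step combines the lower oracle inequality at \<open>\<lambda>\<^sub>k\<^sub>+\<^sub>1\<close>, where the linear model takes the value
  \<open>(1 - a\<^sub>k) h\<^sub>k + a\<^sub>k B\<^sup>w\<^sub>k\<close>, with \<open>h\<^sub>k \<ge> h(\<lambda>\<^sub>k)\<close> and \<open>B\<^sup>w\<^sub>k \<ge> B\<^sub>k\<close>. Quantifying over real \<open>b\<close> keeps the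
  induction inside the reals although \<open>B\<close> may take the value \<open>\<infinity>\<close>.
\<close>

lemma dual_beta_1 [simp]: "dual_beta a (Suc 0) = 1"
  by (simp add: dual_beta_def)

lemma dual_beta_Suc:
  assumes "k \<ge> 1"
  shows "dual_beta a (Suc k) = dual_beta a k / (1 - a k)"
  using assms by (simp add: dual_beta_def prod.atLeastLessThan_Suc)

lemma dual_beta_ge_1:
  assumes "\<And>j. j \<ge> 1 \<Longrightarrow> 0 \<le> a j \<and> a j < 1"
  shows "dual_beta a k \<ge> 1"
proof -
  have "0 < (\<Prod>j\<in>{1..<k}. 1 - a j)"
    using assms by (intro prod_pos) auto
  moreover have "(\<Prod>j\<in>{1..<k}. 1 - a j) \<le> 1"
    using assms by (intro prod_le_1) (auto simp: less_imp_le)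
  ultimately show ?thesis
    by (simp add: dual_beta_def)
qed

lemma dual_alpha_eq:
  assumes "k \<ge> 1"
  shows "dual_alpha a k = dual_beta a (Suc k) * a k"
  using assms by (simp add: dual_alpha_def dual_beta_Suc)

text \<open>The oracle inequalities hold only on \<open>Q\<close>, so they may be used at an iterate
  only once it is known to lie there. Each new iterate is a convex combination of the previous one
  and a maximiser in \<open>Q\<close>. Indices start at \<open>Suc 0\<close> because
  \<open>lam 0\<close> is irrelevant.\<close>

lemma frank_wolfe_iterates_in:
  assumes "convex Q" "frank_wolfe Q h orc a Bo lam lamt B"
  shows "lam (Suc k) \<in> Q"
proof (induction k)
  case 0
  then show ?case using assms by (simp add: frank_wolfe_def)
next
  case (Suc k)
  let ?n = "Suc k"
  have "lamt ?n \<in> Q" "0 \<le> a ?n" "a ?n < 1"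
    and *: "lam (Suc ?n) = lam ?n + a ?n *\<^sub>R (lamt ?n - lam ?n)"
    using assms(2) by (auto simp: frank_wolfe_def is_arg_max_def)
  have "(1 - a ?n) *\<^sub>R lam ?n + a ?n *\<^sub>R lamt ?n \<in> Q"
    using Suc \<open>lamt ?n \<in> Q\<close> \<open>0 \<le> a ?n\<close> \<open>a ?n < 1\<close>
    by (intro convexD[OF assms(1)]) auto
  then show ?case by (simp add: * algebra_simps)
qed

text \<open>A single iteration, detached from the sequences. The displacement is
  \<open>t *\<^sub>R (y - x)\<close>, so the linear term scales with \<open>t\<close> and the
  quadratic error with \<open>t\<^sup>2\<close>; the diameter then makes that error independent of
  the points.\<close>

lemma oracle_step:
  assumes orc: "is_oracle Q h \<delta> L orc" and "L \<ge> 0" "bounded Q"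
    and mem: "x \<in> Q" "y \<in> Q" "x + t *\<^sub>R (y - x) \<in> Q" and t: "0 \<le> t" "t \<le> 1"
    and b: "b \<le> model orc x y"
  shows "(1 - t) * h x + t * b - L / 2 * t\<^sup>2 * (diameter Q)\<^sup>2 - \<delta> \<le> h (x + t *\<^sub>R (y - x))"
proof -
  let ?f = "fst (orc x)" and ?g = "blinfun_apply (snd (orc x)) (y - x)"
  \<comment> \<open>The upper oracle inequality with both points equal to \<open>x\<close>, where
    the linear term vanishes.\<close>
  have fx: "h x \<le> ?f"
    using orc mem(1) by (fastforce simp: is_oracle_def)
  have "h (x + t *\<^sub>R (y - x)) \<ge> ?f + blinfun_apply (snd (orc x)) ((x + t *\<^sub>R (y - x)) - x)
      - L / 2 * (norm ((x + t *\<^sub>R (y - x)) - x))\<^sup>2 - \<delta>"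
    using orc mem unfolding is_oracle_def by blast
  then have lower: "h (x + t *\<^sub>R (y - x)) \<ge> ?f + t * ?g - L / 2 * (t\<^sup>2 * (norm (y - x))\<^sup>2) - \<delta>"
    by (simp add: blinfun.scaleR_right power_mult_distrib)
  have "norm (y - x) \<le> diameter Q"
    using diameter_bounded_bound[OF \<open>bounded Q\<close> mem(2,1)] by (simp add: dist_norm)
  then have "(norm (y - x))\<^sup>2 \<le> (diameter Q)\<^sup>2"
    by (simp add: power_mono)
  then have "L / 2 * (t\<^sup>2 * (norm (y - x))\<^sup>2) \<le> L / 2 * (t\<^sup>2 * (diameter Q)\<^sup>2)"
    using \<open>L \<ge> 0\<close> by (intro mult_left_mono) auto
  moreover have "(1 - t) * h x \<le> (1 - t) * ?f"
    using fx t by (intro mult_left_mono) auto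
  moreover have "t * b \<le> t * (?f + ?g)"
    using b t by (intro mult_left_mono) (auto simp: model_def)
  \<comment> \<open>The two weighted bounds add up to the model value, since
    \<open>(1 - t) * ?f + t * (?f + ?g) = ?f + t * ?g\<close>.\<close>
  ultimately show ?thesis
    using lower by (simp add: algebra_simps)
qed

lemma frank_wolfe_scaled_bound:
  assumes "convex Q" "bounded Q"
    and L: "\<And>i. i \<ge> 1 \<Longrightarrow> L i \<ge> 0"
    and orc: "\<And>i. i \<ge> 1 \<Longrightarrow> is_oracle Q h (\<delta> i) (L i) (orc i)"
    and fw: "frank_wolfe Q h orc a Bo lam lamt B"
    and "ereal b \<le> B k"
  shows "h (lam 1) + (dual_beta a (k + 1) - 1) * b
      - 1/2 * (diameter Q)\<^sup>2 * (\<Sum>i=1..k. L i * ((dual_alpha a i)\<^sup>2 / dual_beta a (i + 1)))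
      - (\<Sum>i=1..k. dual_beta a (i + 1) * \<delta> i)
    \<le> dual_beta a (k + 1) * h (lam (k + 1))"
  using \<open>ereal b \<le> B k\<close>
proof (induction k)
  case 0
  then show ?case by simp
next
  case (Suc k)
  let ?n = "Suc k"
  let ?x = "lam ?n" and ?y = "lamt ?n" and ?t = "a ?n" and ?\<beta> = "dual_beta a (Suc ?n)"
  have y: "?y \<in> Q" and t: "0 \<le> ?t" "?t < 1"
    and x': "lam (Suc ?n) = ?x + ?t *\<^sub>R (?y - ?x)"
    and B: "B ?n = Min {B k, ereal (model (orc ?n) ?x ?y), Bo ?n}"
    using fw by (auto simp: frank_wolfe_def is_arg_max_def)
  \<comment> \<open>Because \<open>B ?n\<close> is a minimum that includes \<open>B k\<close>, the
    same \<open>b\<close> serves in the induction hypothesis.\<close>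
  have b: "ereal b \<le> B k" "b \<le> model (orc ?n) ?x ?y"
    using Suc.prems by (auto simp: B)
  have "?\<beta> \<ge> 1"
    using fw by (intro dual_beta_ge_1) (auto simp: frank_wolfe_def)
  \<comment> \<open>Read this way, scaling by \<open>?\<beta>\<close> turns the weight
    \<open>1 - ?t\<close> on \<open>h ?x\<close> into the coefficient found in the induction
    hypothesis.\<close>
  have \<beta>: "dual_beta a ?n = ?\<beta> * (1 - ?t)"
    using t by (simp add: dual_beta_Suc)
  have \<alpha>: "(dual_alpha a ?n)\<^sup>2 / ?\<beta> = ?\<beta> * ?t\<^sup>2"
    using \<open>?\<beta> \<ge> 1\<close> by (simp add: dual_alpha_eq power2_eq_square)
  note mem = frank_wolfe_iterates_in[OF \<open>convex Q\<close> fw]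
  have "(1 - ?t) * h ?x + ?t * b - L ?n / 2 * ?t\<^sup>2 * (diameter Q)\<^sup>2 - \<delta> ?n \<le> h (lam (Suc ?n))"
    unfolding x'
    using mem[of k] mem[of ?n] y t b L orc \<open>bounded Q\<close> by (intro oracle_step) (auto simp: x')
  then have "?\<beta> * ((1 - ?t) * h ?x + ?t * b - L ?n / 2 * ?t\<^sup>2 * (diameter Q)\<^sup>2 - \<delta> ?n)
      \<le> ?\<beta> * h (lam (Suc ?n))"
    using \<open>?\<beta> \<ge> 1\<close> by (intro mult_left_mono) auto
  moreover have "(\<Sum>i=1..?n. L i * ((dual_alpha a i)\<^sup>2 / dual_beta a (i + 1)))
      = (\<Sum>i=1..k. L i * ((dual_alpha a i)\<^sup>2 / dual_beta a (i + 1))) + L ?n * (?\<beta> * ?t\<^sup>2)"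
    by (simp flip: \<alpha>)
  moreover have "(\<Sum>i=1..?n. dual_beta a (i + 1) * \<delta> i)
      = (\<Sum>i=1..k. dual_beta a (i + 1) * \<delta> i) + ?\<beta> * \<delta> ?n"
    by simp
  moreover have "dual_beta a (k + 1) * b = ?\<beta> * (1 - ?t) * b"
    "dual_beta a (k + 1) * h ?x = ?\<beta> * (1 - ?t) * h ?x"
    by (simp_all add: \<beta>)
  ultimately show ?case
    using Suc.IH[OF b(1)] by (simp add: algebra_simps del: sum.cl_ivl_Suc)
qed

theorem theorem5p3:
  fixes Q :: "'e::real_normed_vector set"
    and h :: "'e \<Rightarrow> real"
    and \<delta> L a :: "nat \<Rightarrow> real"
    and orc :: "nat \<Rightarrow> 'e \<Rightarrow> real \<times> ('e \<Rightarrow>\<^sub>L real)"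
    and lam lamt :: "nat \<Rightarrow> 'e"
    and B Bo :: "nat \<Rightarrow> ereal"
    and k :: nat
  assumes "\<exists>S::'e set. finite S \<and> span S = UNIV"
    and "Q \<noteq> {}" and "convex Q" and "compact Q"
    and "\<And>i. i \<ge> 1 \<Longrightarrow> \<delta> i \<ge> 0"
    and "\<And>i. i \<ge> 1 \<Longrightarrow> L i \<ge> 0"
    and "\<And>i. i \<ge> 1 \<Longrightarrow> is_oracle Q h (\<delta> i) (L i) (orc i)"
    and "frank_wolfe Q h orc a Bo lam lamt B"
  shows "B k - ereal (h (lam (k + 1)))
    \<le> (B k - ereal (h (lam 1))) / ereal (dual_beta a (k + 1))
      + ereal ((1/2 * (diameter Q)\<^sup>2
                * (\<Sum>i=1..k. L i * ((dual_alpha a i)\<^sup>2 / dual_beta a (i + 1))))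
               / dual_beta a (k + 1))
      + ereal ((\<Sum>i=1..k. dual_beta a (i + 1) * \<delta> i) / dual_beta a (k + 1))"
proof -
  let ?\<beta> = "dual_beta a (k + 1)"
  let ?S = "1/2 * (diameter Q)\<^sup>2
    * (\<Sum>i=1..k. L i * ((dual_alpha a i)\<^sup>2 / dual_beta a (i + 1)))"
  let ?D = "\<Sum>i=1..k. dual_beta a (i + 1) * \<delta> i"
  have "?\<beta> \<ge> 1"
    using assms(8) by (intro dual_beta_ge_1) (auto simp: frank_wolfe_def)
  then have pos: "?\<beta> > 0"
    by linarith
  show ?thesis
  proof (cases "B k")
    case (real b)
    have "h (lam 1) + (?\<beta> - 1) * b - ?S - ?D \<le> ?\<beta> * h (lam (k + 1))"
      using assms real by (intro frank_wolfe_scaled_bound) (auto intro: compact_imp_bounded)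
    \<comment> \<open>Subtracting \<open>(?\<beta> - 1) * b\<close> from \<open>?\<beta> * b\<close>
      leaves the single \<open>b\<close> on the right.\<close>
    then have "?\<beta> * (b - h (lam (k + 1))) \<le> (b - h (lam 1)) + ?S + ?D"
      by (simp only: algebra_simps)
    then have "b - h (lam (k + 1)) \<le> ((b - h (lam 1)) + ?S + ?D) / ?\<beta>"
      using pos by (simp only: pos_le_divide_eq mult.commute)
    then have "b - h (lam (k + 1)) \<le> (b - h (lam 1)) / ?\<beta> + ?S / ?\<beta> + ?D / ?\<beta>"
      by (simp only: add_divide_distrib)
    then show ?thesis
      using pos by (simp add: real)
  next
    \<comment> \<open>Dividing \<infinity> by the positive real \<open>?\<beta>\<close> gives
      \<infinity> again, so the right-hand side is infinite. In the remaining case the left-hand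
      side is -\<infinity>.\<close>
    case PInf
    then show ?thesis using pos by simp
  next
    case MInf
    then show ?thesis by simp
  qed
qed

end
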